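(* Let $w\in C([0,1];\mathbb R^d)$ with $w_0=0$, let $b:\mathbb R^d\to\mathbb R^d$ be bounded and continuous, let $\gamma>1/2$, let $\psi$ be a weight, and assume that $\|T^wb\|_{\mathscr C^\gamma([0,1];\mathscr C^{3/2,\psi})}<+\infty$. Then for any $x_0\in\mathbb R^d$ there exists a unique continuous solution $x\in C([0,1];\mathbb R^d)$ of $$x_t=x_0+\int_0^tb(x_s)\,ds+w_t,\qquad t\in[0,1],$$ and the flow map $x_0\mapsto x_t$ of the equation is locally Lipschitz continuous in space, uniformly in $t\in[0,1]$.
   Context: Averaging operator: $T^w_tb(x)=\int_0^tb(x+w_r)\,dr$. A weight is a continuous non-decreasing function $\psi:\mathbb R_+\to\mathbb R_+$ such that for each $c>0$ there is a constant $C_{c,\psi}>0$ with $\psi(cx)\le C_{c,\psi}\psi(x)$ for all $x\geq 0$. $\mathscr C^{3/2,\psi}$ is the space of continuously differentiable $g:\mathbb R^d\to\mathbb R^d$ with $$\|g\|_{\mathscr C^{3/2,\psi}}=\sup_{x\ne y}\frac{|Dg(x)-Dg(y)|}{|x-y|^{1/2}\psi(|x|+|y|)}+|g(0)|+|Dg(0)|<\infty,$$ and $\|T^wb\|_{\mathscr C^\gamma([0,1];\mathscr C^{3/2,\psi})}=\sup_{0\le s<t\le1}\|T^w_tb-T^w_sb\|_{\mathscr C^{3/2,\psi}}/|t-s|^\gamma$. *)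

theory Defs
  imports "HOL-Analysis.Analysis"
begin

definition averaging ::
  "(real \<Rightarrow> real ^ 'n) \<Rightarrow> (real ^ 'n \<Rightarrow> real ^ 'n) \<Rightarrow> real \<Rightarrow> real ^ 'n \<Rightarrow> real ^ 'n" where
  "averaging w b t x = integral {0..t} (\<lambda>r. b (x + w r))"

(* Only the values of psi on [0,\<infinity>) are relevant. *)
definition weight :: "(real \<Rightarrow> real) \<Rightarrow> bool" where
  "weight \<psi> \<longleftrightarrow>
     continuous_on {0..} \<psi> \<and> mono_on {0..} \<psi> \<and> (\<forall>x\<ge>0. \<psi> x \<ge> 0) \<and>
     (\<forall>c>0. \<exists>C>0. \<forall>x\<ge>0. \<psi> (c * x) \<le> C * \<psi> x)"

definition total_deriv ::
  "(real ^ 'n \<Rightarrow> real ^ 'n) \<Rightarrow> real ^ 'n \<Rightarrow> ((real ^ 'n) \<Rightarrow>\<^sub>L (real ^ 'n))" where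
  "total_deriv g x = Blinfun (frechet_derivative g (at x))"

definition cont_diff :: "(real ^ 'n \<Rightarrow> real ^ 'n) \<Rightarrow> bool" where
  "cont_diff g \<longleftrightarrow> (\<forall>x. g differentiable at x) \<and> continuous_on UNIV (total_deriv g)"

(* The norm takes values in [0,\<infinity>] and is \<infinity> off the continuously differentiable functions, so that
   the space C^{3/2,psi} consists of the g of finite norm. |Dg| is the operator norm. In ennreal,
   a / 0 = \<infinity> for a > 0 and 0 / 0 = 0: a vanishing psi forces Dg to be constant (division in the
   reals would instead make the seminorm zero). *)
definition C32_norm :: "(real \<Rightarrow> real) \<Rightarrow> (real ^ 'n \<Rightarrow> real ^ 'n) \<Rightarrow> ennreal" where
  "C32_norm \<psi> g =
     (if cont_diff g then
        (SUP (x, y) \<in> {(x, y). x \<noteq> y}.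
           ennreal (norm (total_deriv g x - total_deriv g y)) /
           ennreal (norm (x - y) powr (1/2) * \<psi> (norm x + norm y)))
        + ennreal (norm (g 0)) + ennreal (norm (total_deriv g 0))
      else \<infinity>)"

definition time_Holder_C32_norm ::
  "real \<Rightarrow> (real \<Rightarrow> real) \<Rightarrow> (real \<Rightarrow> real ^ 'n \<Rightarrow> real ^ 'n) \<Rightarrow> ennreal" where
  "time_Holder_C32_norm \<gamma> \<psi> T =
     (SUP (s, t) \<in> {(s, t). 0 \<le> s \<and> s < t \<and> t \<le> 1}.
        C32_norm \<psi> (\<lambda>x. T t x - T s x) / ennreal (\<bar>t - s\<bar> powr \<gamma>))"

definition solves ::
  "(real \<Rightarrow> real ^ 'n) \<Rightarrow> (real ^ 'n \<Rightarrow> real ^ 'n) \<Rightarrow> real ^ 'n \<Rightarrow> (real \<Rightarrow> real ^ 'n) \<Rightarrow> bool" where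
  "solves w b x0 x \<longleftrightarrow>
     continuous_on {0..1} x \<and>
     (\<forall>t\<in>{0..1}. x t = x0 + integral {0..t} (\<lambda>s. b (x s)) + w t)"

end

theory Submission
  imports Defs "HOL-Complex_Analysis.Great_Picard"
begin

text \<open>
  Subtracting \<open>w\<close> turns the equation into \<open>\<theta>\<^sub>t = x\<^sub>0 + \<integral>\<^sub>0\<^sup>t b (\<theta>\<^sub>r + w\<^sub>r) dr\<close>, whose solutions exist by
  Peano's theorem and are Lipschitz in time. Let \<open>e\<close> be the difference of two solutions \<open>\<theta>\<close>, \<open>\<eta>\<close> and
  \<open>G\<^bsub>s,t\<^esub> = T\<^sub>t b - T\<^sub>s b\<close>. The germ \<open>A\<^bsub>s,t\<^esub> = G\<^bsub>s,t\<^esub> \<theta>\<^sub>s - G\<^bsub>s,t\<^esub> \<eta>\<^sub>s\<close> approximates \<open>e\<^sub>t - e\<^sub>s\<close> up to \<open>o(t - s)\<close>,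
  and its defect of additivity is of order \<open>(t - s)\<^bsup>\<gamma> + 1/2\<^esup>\<close> times the sum of the sup norm and the
  1/2-Hoelder constant of \<open>e\<close>, by the regularity of \<open>G\<close>. As \<open>\<gamma> + 1/2 > 1\<close>, repeated halving of
  \<open>[s,t]\<close> bounds \<open>e\<^sub>t - e\<^sub>s - A\<^bsub>s,t\<^esub>\<close> by the same quantity. On short intervals this absorbs the Hoelder
  constant of \<open>e\<close>, so \<open>\<bar>e\<bar>\<close> at most doubles there, and finitely many such intervals cover \<open>[0,1]\<close>.
\<close>

section \<open>Sewing estimate by repeated halving\<close>

text \<open>The midpoint defects of the \<open>k\<close>-th halving add up to at most
  \<open>N * (t - s) powr p * 2 powr (k * (1 - p))\<close>, a convergent geometric series because
  \<open>p > 1\<close>. The pieces at the finest level are controlled by \<open>small\<close>, with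
  an arbitrarily small total. In the application \<open>R\<close> is the norm of the remainder left
  by a germ.\<close>

lemma midpoint_sewing:
  fixes R :: "real \<Rightarrow> real \<Rightarrow> real"
  assumes p: "p > 1" and N: "N \<ge> 0"
    and mid: "\<And>s t. a \<le> s \<Longrightarrow> s < t \<Longrightarrow> t \<le> c \<Longrightarrow>
      R s t \<le> R s ((s + t) / 2) + R ((s + t) / 2) t + N * (t - s) powr p"
    and small: "\<And>\<epsilon>. \<epsilon> > 0 \<Longrightarrow> \<exists>\<delta>>0. \<forall>s t. a \<le> s \<longrightarrow> s < t \<longrightarrow> t \<le> c \<longrightarrow> t - s \<le> \<delta> \<longrightarrow>
      R s t \<le> \<epsilon> * (t - s)"
    and st: "a \<le> s" "s < t" "t \<le> c"
  shows "R s t \<le> N / (1 - 2 powr (1 - p)) * (t - s) powr p"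
proof -
  \<comment> \<open>The solution of \<open>2 C / 2\<^sup>p + 1 = C\<close>, so that the bound reproduces itself under halving.\<close>
  define C where "C = 1 / (1 - 2 powr (1 - p))"
  have q: "2 powr (1 - p) < (1::real)"
    using p by (simp add: powr_less_one)
  then have C0: "C \<ge> 0" by (simp add: C_def)
  have "C * (1 - 2 powr (1 - p)) = 1" using p by (simp add: C_def)
  then have C: "C * 2 powr (1 - p) + 1 = C" by (simp add: right_diff_distrib)
  have "R s t \<le> C * N * (t - s) powr p + \<epsilon> * (t - s)" if \<epsilon>: "\<epsilon> > 0" for \<epsilon>
  proof -
    obtain \<delta> where \<delta>: "\<delta> > 0" and sm: "\<And>s t. a \<le> s \<Longrightarrow> s < t \<Longrightarrow> t \<le> c \<Longrightarrow> t - s \<le> \<delta> \<Longrightarrow>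
      R s t \<le> \<epsilon> * (t - s)"
      using small[OF \<epsilon>] by blast
    \<comment> \<open>Induction on the number of halvings that bring the length down to
      \<open>\<delta>\<close>. The term \<open>\<epsilon> * (t - s)\<close> is additive in the
      length, so halving does not enlarge it.\<close>
    have ind: "R s t \<le> C * N * (t - s) powr p + \<epsilon> * (t - s)"
      if "a \<le> s" "s < t" "t \<le> c" "t - s \<le> 2 ^ n * \<delta>" for n s t
      using that
    proof (induction n arbitrary: s t)
      case 0
      have "R s t \<le> \<epsilon> * (t - s)" using 0 by (intro sm) auto
      moreover have "0 \<le> C * N * (t - s) powr p" using C0 N by simp
      ultimately show ?case by linarith
    next
      case (Suc n)
      define u where "u = (s + t) / 2"
      define h where "h = t - s"
      have u: "s < u" "u < t" "u - s = h / 2" "t - u = h / 2"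
        using Suc.prems by (auto simp: u_def h_def field_simps)
      have h: "h > 0" "h / 2 \<le> 2 ^ n * \<delta>" using Suc.prems by (auto simp: h_def)
      have "R s u \<le> C * N * (u - s) powr p + \<epsilon> * (u - s)"
        using Suc.prems u h by (intro Suc.IH) auto
      moreover have "R u t \<le> C * N * (t - u) powr p + \<epsilon> * (t - u)"
        using Suc.prems u h by (intro Suc.IH) auto
      moreover have "R s t \<le> R s u + R u t + N * h powr p"
        using mid[of s t] Suc.prems by (simp add: u_def h_def)
      ultimately have "R s t \<le> 2 * (C * N * (h / 2) powr p) + \<epsilon> * h + N * h powr p"
        unfolding u by argo
      also have "2 * (C * N * (h / 2) powr p) = C * N * h powr p * 2 powr (1 - p)"
        using h by (simp add: powr_divide powr_diff)
      also have "C * N * h powr p * 2 powr (1 - p) + \<epsilon> * h + N * h powr p =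
          (C * 2 powr (1 - p) + 1) * N * h powr p + \<epsilon> * h"
        by (simp add: algebra_simps)
      finally show ?case unfolding C h_def .
    qed
    obtain n where "(t - s) / \<delta> < 2 ^ n"
      using real_arch_pow[of 2 "(t - s) / \<delta>"] by auto
    then show ?thesis
      using ind[OF st, of n] \<delta> by (simp add: field_simps)
  qed
  \<comment> \<open>The choice \<open>\<epsilon> = e / (t - s)\<close> makes the slack an arbitrary
    \<open>e > 0\<close>.\<close>
  from this[of "e / (t - s)" for e] have "R s t \<le> C * N * (t - s) powr p + e" if "e > 0" for e
    using that st by auto
  then have "R s t \<le> C * N * (t - s) powr p"
    by (rule field_le_epsilon)
  then show ?thesis by (simp add: C_def)
qed

section \<open>Maps with a Hoelder continuous derivative on a ball\<close>

text \<open>One constant serves for the size of the derivative and for its 1/2-Hoelder seminorm. The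
  bounds are confined to a ball because the weight may grow at infinity.\<close>

definition holder_deriv_bound :: "real \<Rightarrow> real \<Rightarrow> ('a::real_normed_vector \<Rightarrow> 'a) \<Rightarrow> bool" where
  "holder_deriv_bound L R g \<longleftrightarrow> (\<exists>D.
     (\<forall>x. (g has_derivative blinfun_apply (D x)) (at x)) \<and>
     (\<forall>x\<in>cball 0 R. norm (D x) \<le> L) \<and>
     (\<forall>x\<in>cball 0 R. \<forall>y\<in>cball 0 R. norm (D x - D y) \<le> L * sqrt (norm (x - y))))"

lemma holder_deriv_bound_lipschitz:
  fixes g :: "'a::real_normed_vector \<Rightarrow> 'a"
  assumes "holder_deriv_bound L R g" "x \<in> cball 0 R" "y \<in> cball 0 R"
  shows "norm (g x - g y) \<le> L * norm (x - y)"
proof -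
  obtain D where D: "\<And>x. (g has_derivative blinfun_apply (D x)) (at x)"
    "\<And>x. x \<in> cball 0 R \<Longrightarrow> norm (D x) \<le> L"
    using assms(1) unfolding holder_deriv_bound_def by blast
  show ?thesis
    by (rule differentiable_bound[of "cball 0 R" g "\<lambda>x. blinfun_apply (D x)"])
      (use D assms in \<open>auto intro: has_derivative_at_withinI simp flip: norm_blinfun.rep_eq\<close>)
qed

text \<open>The increments of \<open>g\<close> along the segments from \<open>b\<close> to
  \<open>a\<close> and from \<open>d\<close> to \<open>c\<close> are compared by the mean value
  inequality. The difference of directions costs the size of the derivative, the distance of the
  segments its Hoelder seminorm. With two curves evaluated at two times this bounds the defect of
  additivity of the germ.\<close>

lemma holder_deriv_bound_four_points:
  fixes g :: "'a::real_normed_vector \<Rightarrow> 'a"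
  assumes g: "holder_deriv_bound L R g"
    and R: "a \<in> cball 0 R" "b \<in> cball 0 R" "c \<in> cball 0 R" "d \<in> cball 0 R"
    and m: "norm (a - c) \<le> m" "norm (b - d) \<le> m"
  shows "norm ((g a - g b) - (g c - g d)) \<le>
    L * (norm ((a - b) - (c - d)) + sqrt m * norm (c - d))"
proof -
  obtain D where D: "\<And>x. (g has_derivative blinfun_apply (D x)) (at x)"
    "\<And>x. x \<in> cball 0 R \<Longrightarrow> norm (D x) \<le> L"
    "\<And>x y. x \<in> cball 0 R \<Longrightarrow> y \<in> cball 0 R \<Longrightarrow> norm (D x - D y) \<le> L * sqrt (norm (x - y))"
    using g unfolding holder_deriv_bound_def by blast
  have L: "L \<ge> 0" using D(2)[OF R(1)] norm_ge_zero[of "D a"] by linarith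
  define p where "p = (\<lambda>l::real. b + l *\<^sub>R (a - b))"
  define q where "q = (\<lambda>l::real. d + l *\<^sub>R (c - d))"
  define B where "B = L * (norm ((a - b) - (c - d)) + sqrt m * norm (c - d))"
  have pq: "p l \<in> cball 0 R" "q l \<in> cball 0 R" if "l \<in> {0..1}" for l
  proof -
    have "(1 - l) *\<^sub>R b + l *\<^sub>R a \<in> cball 0 R" "(1 - l) *\<^sub>R d + l *\<^sub>R c \<in> cball 0 R"
      using that R by (intro convexD[OF convex_cball]; simp)+
    then show "p l \<in> cball 0 R" "q l \<in> cball 0 R"
      by (auto simp: p_def q_def algebra_simps)
  qed
  have der: "((\<lambda>l. g (p l) - g (q l)) has_derivative
      (\<lambda>h. blinfun_apply (D (p l)) (h *\<^sub>R (a - b)) - blinfun_apply (D (q l)) (h *\<^sub>R (c - d)))) (at l within {0..1})" for l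
  proof -
    have 1: "(p has_derivative (\<lambda>h. h *\<^sub>R (a - b))) (at l within {0..1})"
      "(q has_derivative (\<lambda>h. h *\<^sub>R (c - d))) (at l within {0..1})"
      unfolding p_def q_def by (auto intro!: derivative_eq_intros)
    show ?thesis
      by (intro has_derivative_diff has_derivative_compose[OF 1(1) D(1)] has_derivative_compose[OF 1(2) D(1)])
  qed
  have B: "onorm (\<lambda>h. blinfun_apply (D (p l)) (h *\<^sub>R (a - b)) - blinfun_apply (D (q l)) (h *\<^sub>R (c - d))) \<le> B"
    if l: "l \<in> {0..1}" for l
  proof (rule onorm_le)
    fix h :: real
    \<comment> \<open>Points with equal parameter differ by a convex combination of
      \<open>b - d\<close> and \<open>a - c\<close>, so \<open>m\<close> bounds their distance for
      every \<open>l\<close>.\<close>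
    have "p l - q l = (1 - l) *\<^sub>R (b - d) + l *\<^sub>R (a - c)"
      by (simp add: p_def q_def algebra_simps)
    also have "norm \<dots> \<le> (1 - l) * norm (b - d) + l * norm (a - c)"
      using l by (intro norm_triangle_le) auto
    also have "\<dots> \<le> (1 - l) * m + l * m"
      using l m by (intro add_mono mult_left_mono) auto
    finally have m': "norm (p l - q l) \<le> m" by (simp add: algebra_simps)
    have "norm (D (p l) - D (q l)) \<le> L * sqrt (norm (p l - q l))"
      using D(3) pq l by blast
    also have "\<dots> \<le> L * sqrt m" using m' L by (intro mult_left_mono) auto
    finally have hol: "norm (D (p l) - D (q l)) \<le> L * sqrt m" .
    \<comment> \<open>The mixed term \<open>D (p l)\<close> applied to \<open>c - d\<close> is
      subtracted and added.\<close>
    have "blinfun_apply (D (p l)) (h *\<^sub>R (a - b)) - blinfun_apply (D (q l)) (h *\<^sub>R (c - d)) =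
      h *\<^sub>R (blinfun_apply (D (p l)) ((a - b) - (c - d)) + blinfun_apply (D (p l) - D (q l)) (c - d))"
      by (simp add: blinfun.bilinear_simps algebra_simps)
    also have "norm \<dots> \<le> \<bar>h\<bar> * (norm (D (p l)) * norm ((a - b) - (c - d)) + norm (D (p l) - D (q l)) * norm (c - d))"
      unfolding norm_scaleR by (intro mult_left_mono norm_triangle_le add_mono norm_blinfun) auto
    also have "\<dots> \<le> \<bar>h\<bar> * (L * norm ((a - b) - (c - d)) + (L * sqrt m) * norm (c - d))"
      using D(2)[OF pq(1)[OF l]] hol by (intro mult_left_mono add_mono mult_right_mono) auto
    also have "\<dots> = B * norm h" by (simp add: B_def algebra_simps)
    finally show "norm (blinfun_apply (D (p l)) (h *\<^sub>R (a - b)) - blinfun_apply (D (q l)) (h *\<^sub>R (c - d))) \<le> B * norm h" .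
  qed
  have "norm ((g (p 1) - g (q 1)) - (g (p 0) - g (q 0))) \<le> B * norm (1 - 0 :: real)"
    by (rule differentiable_bound[OF _ der B]) auto
  then show ?thesis by (simp add: p_def q_def B_def algebra_simps)
qed

section \<open>Local bounds from the weighted norms\<close>

text \<open>For \<open>d = 0\<close> a finite quotient forces \<open>ennreal a = 0\<close>, hence
  \<open>a \<le> 0\<close>. This is how a vanishing weight is handled. A negative \<open>a\<close>
  is truncated by \<open>ennreal\<close>, but then the claim follows from the signs.\<close>

lemma ennreal_le_mult_of_divide_le:
  fixes a k d :: real
  assumes "ennreal a / ennreal d \<le> ennreal k" "k \<ge> 0" "d \<ge> 0"
  shows "a \<le> k * d"
proof (cases "d = 0")
  case True
  then show ?thesis using assms(1) by (auto simp: top_unique ennreal_eq_0_iff split: if_splits)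
next
  case False
  show ?thesis
  proof (cases "a \<ge> 0")
    case True
    then have "a / d \<le> k" using assms False by (simp add: divide_ennreal)
    then show ?thesis using False assms by (simp add: field_simps)
  qed (use assms in \<open>smt (verit) mult_nonneg_nonneg\<close>)
qed

lemma C32_norm_bounds:
  fixes g :: "real ^ 'n \<Rightarrow> real ^ 'n"
  assumes "C32_norm \<psi> g \<le> ennreal k" "k \<ge> 0" "\<And>r. r \<ge> 0 \<Longrightarrow> \<psi> r \<ge> 0"
  shows "(g has_derivative blinfun_apply (total_deriv g x)) (at x)"
    and "norm (total_deriv g 0) \<le> k"
    and "norm (total_deriv g x - total_deriv g y) \<le> k * (sqrt (norm (x - y)) * \<psi> (norm x + norm y))"
proof -
  have cd: "cont_diff g"
    using assms(1) by (auto simp: C32_norm_def top_unique split: if_splits)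
  then have "(g has_derivative frechet_derivative g (at x)) (at x)"
    by (simp add: cont_diff_def frechet_derivative_works)
  then show "(g has_derivative blinfun_apply (total_deriv g x)) (at x)"
    \<comment> \<open>\<open>Blinfun\<close> is faithful only on bounded linear maps, and a Frechet
      derivative is one.\<close>
    by (metis bounded_linear_Blinfun_apply has_derivative_bounded_linear total_deriv_def)
  let ?S = "SUP (x, y) \<in> {(x, y). x \<noteq> y}.
           ennreal (norm (total_deriv g x - total_deriv g y)) /
           ennreal (norm (x - y) powr (1/2) * \<psi> (norm x + norm y))"
  have le: "?S + ennreal (norm (g 0)) + ennreal (norm (total_deriv g 0)) \<le> ennreal k"
    using assms(1) cd by (simp add: C32_norm_def)
  have "ennreal (norm (total_deriv g 0)) \<le> ennreal k"
    by (rule order_trans[OF _ le]) (simp add: add_increasing)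
  then show "norm (total_deriv g 0) \<le> k" using assms by simp
  show "norm (total_deriv g x - total_deriv g y) \<le> k * (sqrt (norm (x - y)) * \<psi> (norm x + norm y))"
  proof (cases "x = y")
    case False
    have "ennreal (norm (total_deriv g x - total_deriv g y)) /
        ennreal (norm (x - y) powr (1/2) * \<psi> (norm x + norm y)) \<le> ?S"
      by (rule SUP_upper2[of "(x, y)"]) (use False in auto)
    also have "?S \<le> ?S + ennreal (norm (g 0)) + ennreal (norm (total_deriv g 0))"
      by (simp add: add.assoc)
    also note le
    finally show ?thesis
      using ennreal_le_mult_of_divide_le[of _ "norm (x - y) powr (1/2) * \<psi> (norm x + norm y)" k] assms
      by (simp add: powr_half_sqrt)
  qed simp
qed

text \<open>On the ball of radius \<open>R\<close> the argument \<open>norm x + norm y\<close> of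
  the monotone weight is at most \<open>2 * R\<close>, so the weighted bounds become bounds with the
  single factor \<open>\<psi> (2 * R)\<close>.\<close>

lemma time_Holder_C32_holder_deriv_bound:
  fixes T :: "real \<Rightarrow> real ^ 'n \<Rightarrow> real ^ 'n"
  assumes "time_Holder_C32_norm \<gamma> \<psi> T < \<infinity>" "weight \<psi>" "R \<ge> 0"
  shows "\<exists>L\<ge>0. \<forall>s t. 0 \<le> s \<longrightarrow> s < t \<longrightarrow> t \<le> 1 \<longrightarrow>
     holder_deriv_bound (L * (t - s) powr \<gamma>) R (\<lambda>x. T t x - T s x)"
proof -
  have \<psi>: "\<psi> r \<ge> 0" if "r \<ge> 0" for r using assms(2) that by (auto simp: weight_def)
  have \<psi>m: "\<psi> r \<le> \<psi> r'" if "r \<ge> 0" "r \<le> r'" for r r'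
    using assms(2) that by (auto simp: weight_def mono_on_def)
  obtain K where K: "time_Holder_C32_norm \<gamma> \<psi> T = ennreal K" "K \<ge> 0"
    using assms(1) by (cases "time_Holder_C32_norm \<gamma> \<psi> T") auto
  \<comment> \<open>The derivative is at most its value at \<open>0\<close> plus its variation over
    distance \<open>R\<close>, which gives \<open>K + K * sqrt R * \<psi> (2 * R)\<close>; the
    Hoelder seminorm is at most \<open>K * \<psi> (2 * R)\<close>. The sum dominates both.\<close>
  define L where "L = K * (1 + (1 + sqrt R) * \<psi> (2 * R))"
  have L1: "L = K + K * \<psi> (2 * R) + K * sqrt R * \<psi> (2 * R)" by (simp add: L_def algebra_simps)
  have P: "0 \<le> K * \<psi> (2 * R)" "0 \<le> K * sqrt R * \<psi> (2 * R)"
    using K(2) \<psi>[of "2 * R"] assms(3) by auto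
  have "L \<ge> 0" using P K(2) L1 by linarith
  moreover have "holder_deriv_bound (L * (t - s) powr \<gamma>) R (\<lambda>x. T t x - T s x)"
    if st: "0 \<le> s" "s < t" "t \<le> 1" for s t
  proof -
    define g where "g = (\<lambda>x. T t x - T s x)"
    define H where "H = (t - s) powr \<gamma>"
    have H: "H > 0" using st by (simp add: H_def)
    have "C32_norm \<psi> g / ennreal (\<bar>t - s\<bar> powr \<gamma>) \<le> time_Holder_C32_norm \<gamma> \<psi> T"
      unfolding time_Holder_C32_norm_def g_def by (rule SUP_upper2[of "(s, t)"]) (use st in auto)
    then have *: "C32_norm \<psi> g / ennreal H \<le> ennreal K" using st by (simp add: K(1) H_def)
    have "C32_norm \<psi> g \<le> ennreal (K * H)"
    proof (cases "C32_norm \<psi> g")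
      case (real r)
      then show ?thesis using * ennreal_le_mult_of_divide_le[of r H K] H K by (auto intro!: ennreal_leI)
    next
      case top
      then show ?thesis using * H by (auto simp: ennreal_top_divide top_unique)
    qed
    note D = C32_norm_bounds[OF this _ \<psi>]
    have KH: "K * H \<ge> 0" using K H by simp
    have h: "norm (total_deriv g x - total_deriv g y) \<le> K * H * \<psi> (2 * R) * sqrt (norm (x - y))"
      if "x \<in> cball 0 R" "y \<in> cball 0 R" for x y
    proof -
      have "norm (total_deriv g x - total_deriv g y) \<le> K * H * (sqrt (norm (x - y)) * \<psi> (norm x + norm y))"
        using D(3) KH by blast
      also have "\<dots> \<le> K * H * (sqrt (norm (x - y)) * \<psi> (2 * R))"
        using that KH by (intro mult_left_mono \<psi>m) auto
      finally show ?thesis by (simp add: mult_ac)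
    qed
    have "norm (total_deriv g x) \<le> L * H" if x: "x \<in> cball 0 R" for x
    proof -
      have "norm (total_deriv g x) \<le> norm (total_deriv g x - total_deriv g 0) + norm (total_deriv g 0)"
        by (metis diff_add_cancel norm_triangle_ineq)
      also have "\<dots> \<le> K * H * \<psi> (2 * R) * sqrt (norm (x - 0)) + K * H"
        using h[of x 0] D(2)[OF KH] x assms(3) by (intro add_mono) auto
      also have "\<dots> \<le> K * H * \<psi> (2 * R) * sqrt R + K * H"
        using x KH \<psi>[of "2 * R"] assms(3) by (intro add_right_mono mult_left_mono) auto
      also have "\<dots> = (K + K * sqrt R * \<psi> (2 * R)) * H" by (simp add: algebra_simps)
      also have "\<dots> \<le> L * H" using P H by (intro mult_right_mono) (auto simp: L1)
      finally show ?thesis .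
    qed
    moreover have "norm (total_deriv g x - total_deriv g y) \<le> L * H * sqrt (norm (x - y))"
      if "x \<in> cball 0 R" "y \<in> cball 0 R" for x y
    proof -
      have "K * H * \<psi> (2 * R) = (K * \<psi> (2 * R)) * H" by simp
      also have "\<dots> \<le> L * H" using P H K by (intro mult_right_mono) (auto simp: L1)
      finally show ?thesis using h[OF that] by (meson mult_right_mono norm_ge_zero order_trans real_sqrt_ge_zero)
    qed
    ultimately show ?thesis
      unfolding holder_deriv_bound_def H_def[symmetric] g_def[symmetric]
      using D(1)[OF KH] by blast
  qed
  ultimately show ?thesis by blast
qed

section \<open>Integral curves of a bounded continuous field\<close>

text \<open>With \<open>f r z = b (z + w r)\<close> this is the equation for \<open>x - w\<close>,
  whose solutions are Lipschitz in time although \<open>w\<close> is merely continuous.\<close>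

definition integral_curve :: "(real \<Rightarrow> 'a::euclidean_space \<Rightarrow> 'a) \<Rightarrow> 'a \<Rightarrow> (real \<Rightarrow> 'a) \<Rightarrow> bool" where
  "integral_curve f x0 \<theta> \<longleftrightarrow> continuous_on {0..1} \<theta> \<and>
     (\<forall>t\<in>{0..1}. \<theta> t = x0 + integral {0..t} (\<lambda>r. f r (\<theta> r)))"

lemma continuous_on_along_curve:
  assumes "continuous_on (S \<times> UNIV) (\<lambda>(r, x). f r x)" "continuous_on T \<theta>" "T \<subseteq> S"
  shows "continuous_on T (\<lambda>r. f r (\<theta> r))"
proof -
  have "continuous_on T (\<lambda>r. (\<lambda>(r, x). f r x) (r, \<theta> r))"
    by (rule continuous_on_compose2[OF assms(1)]) (use assms in \<open>auto intro!: continuous_intros\<close>)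
  then show ?thesis by simp
qed

lemma integral_curve_increment:
  assumes cont: "continuous_on ({0..1} \<times> UNIV) (\<lambda>(r, x). f r x)"
    and \<theta>: "integral_curve f x0 \<theta>" and st: "0 \<le> s" "s \<le> t" "t \<le> 1"
  shows "\<theta> t - \<theta> s = integral {s..t} (\<lambda>r. f r (\<theta> r))"
proof -
  have "continuous_on {0..t} (\<lambda>r. f r (\<theta> r))"
    using \<theta> st by (intro continuous_on_along_curve[OF cont])
      (auto simp: integral_curve_def elim!: continuous_on_subset)
  then have "integral {0..s} (\<lambda>r. f r (\<theta> r)) + integral {s..t} (\<lambda>r. f r (\<theta> r)) =
      integral {0..t} (\<lambda>r. f r (\<theta> r))"
    using st by (intro Henstock_Kurzweil_Integration.integral_combine integrable_continuous_interval) auto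
  moreover have "\<theta> s = x0 + integral {0..s} (\<lambda>r. f r (\<theta> r))" "\<theta> t = x0 + integral {0..t} (\<lambda>r. f r (\<theta> r))"
    using \<theta> st by (auto simp: integral_curve_def)
  ultimately show ?thesis by (simp add: algebra_simps)
qed

lemma integral_curve_lipschitz:
  assumes cont: "continuous_on ({0..1} \<times> UNIV) (\<lambda>(r, x). f r x)"
    and bnd: "\<And>r x. r \<in> {0..1} \<Longrightarrow> norm (f r x) \<le> M"
    and \<theta>: "integral_curve f x0 \<theta>" and st: "0 \<le> s" "s \<le> t" "t \<le> 1"
  shows "norm (\<theta> t - \<theta> s) \<le> M * (t - s)"
  unfolding integral_curve_increment[OF cont \<theta> st]
  using \<theta> st bnd by (intro integral_bound continuous_on_along_curve[OF cont])
      (auto simp: integral_curve_def elim!: continuous_on_subset)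

text \<open>Freezing the curve at the left endpoint changes the integrand by little, uniformly in
  \<open>s\<close>. This supplies the assumption \<open>small\<close> of
  \<open>midpoint_sewing\<close>.\<close>

lemma integral_curve_remainder:
  assumes cont: "continuous_on ({0..1} \<times> UNIV) (\<lambda>(r, x). f r x)"
    and \<theta>: "integral_curve f x0 \<theta>" and \<epsilon>: "\<epsilon> > 0"
  shows "\<exists>\<delta>>0. \<forall>s t. 0 \<le> s \<longrightarrow> s < t \<longrightarrow> t \<le> 1 \<longrightarrow> t - s \<le> \<delta> \<longrightarrow>
    norm (\<theta> t - \<theta> s - integral {s..t} (\<lambda>r. f r (\<theta> s))) \<le> \<epsilon> * (t - s)"
proof -
  \<comment> \<open>Separating the time of the curve from the time of the field turns freezing into
    a move of the first coordinate, from \<open>(r, r)\<close> to \<open>(s, r)\<close>, inside a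
    compact square.\<close>
  define F where "F = (\<lambda>(s, r). f r (\<theta> s))"
  have \<theta>c: "continuous_on {0..1} \<theta>" using \<theta> by (simp add: integral_curve_def)
  have "continuous_on ({0..1} \<times> {0..1}) (\<lambda>p. (\<lambda>(r, x). f r x) (snd p, \<theta> (fst p)))"
    by (rule continuous_on_compose2[OF cont])
      (auto intro!: continuous_intros continuous_on_compose2[OF \<theta>c])
  then have "continuous_on ({0..1} \<times> {0..1}) F"
    by (simp add: F_def case_prod_beta)
  then have "uniformly_continuous_on ({0..1} \<times> {0..1}) F"
    by (intro compact_uniformly_continuous compact_Times) auto
  then obtain d where d: "d > 0" and D: "\<And>p q. p \<in> {0..1} \<times> {0..1} \<Longrightarrow> q \<in> {0..1} \<times> {0..1} \<Longrightarrow>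
      dist q p < d \<Longrightarrow> dist (F q) (F p) < \<epsilon>"
    using \<epsilon> unfolding uniformly_continuous_on_def by metis
  have "norm (\<theta> t - \<theta> s - integral {s..t} (\<lambda>r. f r (\<theta> s))) \<le> \<epsilon> * (t - s)"
    if st: "0 \<le> s" "s < t" "t \<le> 1" "t - s \<le> d / 2" for s t
  proof -
    have c1: "continuous_on {s..t} (\<lambda>r. f r (\<theta> r))"
      using st by (intro continuous_on_along_curve[OF cont] continuous_on_subset[OF \<theta>c]) auto
    have c2: "continuous_on {s..t} (\<lambda>r. f r (\<theta> s))"
      using st by (intro continuous_on_along_curve[OF cont]) auto
    have "\<theta> t - \<theta> s - integral {s..t} (\<lambda>r. f r (\<theta> s)) =
        integral {s..t} (\<lambda>r. f r (\<theta> r) - f r (\<theta> s))"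
      using st integral_curve_increment[OF cont \<theta>, of s t]
      by (simp add: Henstock_Kurzweil_Integration.integral_diff integrable_continuous_interval c1 c2)
    also have "norm \<dots> \<le> \<epsilon> * (t - s)"
    proof (rule integral_bound)
      fix r assume r: "r \<in> {s..t}"
      have "dist (F (r, r)) (F (s, r)) < \<epsilon>"
        using r st d by (intro D) (auto simp: dist_prod_def dist_real_def)
      then show "norm (f r (\<theta> r) - f r (\<theta> s)) \<le> \<epsilon>"
        by (simp add: F_def dist_norm)
    qed (use st c1 c2 in \<open>auto intro!: continuous_intros\<close>)
    finally show ?thesis .
  qed
  then show ?thesis using d by (intro exI[of _ "d / 2"]) auto
qed

section \<open>Stability in the initial value\<close>

text \<open>The germ is of order \<open>(t - s) powr \<gamma>\<close> by the Lipschitz bound, and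
  the remainder is at most of that order by sewing with exponent \<open>\<gamma> + 1/2\<close>.
  Splitting off \<open>sqrt (t - s)\<close> leaves a positive power of the length, so on short
  intervals the new Hoelder constant is a small multiple of \<open>norm (e a) + Q\<close>.\<close>

lemma holder_constant_improvement:
  fixes f :: "real \<Rightarrow> 'a::euclidean_space \<Rightarrow> 'a"
  assumes cont: "continuous_on ({0..1} \<times> UNIV) (\<lambda>(r, x). f r x)"
    and bnd: "\<And>r x. r \<in> {0..1} \<Longrightarrow> norm (f r x) \<le> M"
    and hold: "\<And>s t. 0 \<le> s \<Longrightarrow> s < t \<Longrightarrow> t \<le> 1 \<Longrightarrow>
      holder_deriv_bound (L * (t - s) powr \<gamma>) R (\<lambda>x. integral {s..t} (\<lambda>r. f r x))"
    and L: "L \<ge> 0" and \<gamma>: "\<gamma> > 1/2"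
    and curves: "integral_curve f x \<theta>" "integral_curve f y \<eta>"
    and R: "\<And>t. t \<in> {0..1} \<Longrightarrow> \<theta> t \<in> cball 0 R" "\<And>t. t \<in> {0..1} \<Longrightarrow> \<eta> t \<in> cball 0 R"
    and ac: "0 \<le> a" "c \<le> 1" and Q: "Q \<ge> 0"
    and e_def: "e = (\<lambda>t. \<theta> t - \<eta> t)"
    and eQ: "\<And>s t. a \<le> s \<Longrightarrow> s < t \<Longrightarrow> t \<le> c \<Longrightarrow> norm (e t - e s) \<le> Q * sqrt (t - s)"
    and st: "a \<le> s" "s < t" "t \<le> c"
  shows "norm (e t - e s) \<le>
    L * (1 + (1 + sqrt M) / (1 - 2 powr (1/2 - \<gamma>))) * (c - a) powr (\<gamma> - 1/2) * (norm (e a) + Q) * sqrt (t - s)"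
proof -
  define G where "G = (\<lambda>s t x. integral {s..t} (\<lambda>r. f r x))"
  define A where "A = (\<lambda>s t. G s t (\<theta> s) - G s t (\<eta> s))"
  \<comment> \<open>\<open>S\<close> dominates both \<open>Q\<close> and the sup norm of
    \<open>e\<close> on \<open>[a, c]\<close>; \<open>N\<close> is the resulting constant in the
    defect of additivity of \<open>A\<close>.\<close>
  define S where "S = norm (e a) + Q"
  define N where "N = L * ((1 + sqrt M) * S)"
  have M: "M \<ge> 0" using bnd[of 0 0] norm_ge_zero[of "f 0 0"] by (smt (verit) atLeastAtMost_iff)
  have S0: "S \<ge> 0" using Q by (simp add: S_def)
  have N0: "N \<ge> 0" using S0 L M by (simp add: N_def)
  have eS: "norm (e u) \<le> S" if "a \<le> u" "u \<le> c" for u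
  proof (cases "a = u")
    case False
    have "norm (e u - e a) \<le> Q * sqrt (u - a)" using that False by (intro eQ) auto
    also have "\<dots> \<le> Q * 1" using Q that ac by (intro mult_left_mono) auto
    finally show ?thesis using norm_triangle_ineq[of "e u - e a" "e a"] by (simp add: S_def)
  qed (use Q in \<open>simp add: S_def\<close>)
  have Gadd: "G s t z = G s u z + G u t z" if "0 \<le> s" "s \<le> u" "u \<le> t" "t \<le> 1" for s u t z
    unfolding G_def using that
    by (intro Henstock_Kurzweil_Integration.integral_combine[symmetric] integrable_continuous_interval
        continuous_on_along_curve[OF cont]) auto
  have remain: "norm (e t - e s - A s t) \<le> N / (1 - 2 powr (1 - (\<gamma> + 1/2))) * (t - s) powr (\<gamma> + 1/2)"
  proof (rule midpoint_sewing[where R = "\<lambda>s t. norm (e t - e s - A s t)" and a = a and c = c])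
    fix s t assume st: "a \<le> s" "s < t" "t \<le> c"
    define u where "u = (s + t) / 2"
    define h where "h = t - s"
    have u: "s < u" "u < t" "u - s = h / 2" "t - u = h / 2" "0 \<le> u" "u \<le> 1"
      using st ac by (auto simp: u_def h_def field_simps)
    have h: "h > 0" using st by (simp add: h_def)
    have Mh: "M * (u - s) \<le> M * h" using u h M by (intro mult_left_mono) auto
    have "norm (\<theta> u - \<theta> s) \<le> M * (u - s)"
      by (rule integral_curve_lipschitz[OF cont bnd curves(1)]) (use st ac u in auto)
    moreover have "norm (\<eta> u - \<eta> s) \<le> M * (u - s)"
      by (rule integral_curve_lipschitz[OF cont bnd curves(2)]) (use st ac u in auto)
    ultimately have lip: "norm (\<theta> s - \<theta> u) \<le> M * h" "norm (\<eta> s - \<eta> u) \<le> M * h"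
      using Mh by (metis norm_minus_commute order_trans)+
    \<comment> \<open>Since \<open>G\<close> is additive in time, the defect comes only from moving
      the base points from time \<open>s\<close> to time \<open>u\<close> in the part over
      \<open>[u, t]\<close>.\<close>
    have "A s t = A s u + A u t + ((G u t (\<theta> s) - G u t (\<eta> s)) - (G u t (\<theta> u) - G u t (\<eta> u)))"
      using Gadd[of s u t] st ac u by (simp add: A_def)
    then have "e t - e s - A s t = (e u - e s - A s u) + (e t - e u - A u t) -
        ((G u t (\<theta> s) - G u t (\<eta> s)) - (G u t (\<theta> u) - G u t (\<eta> u)))"
      by simp
    then have "norm (e t - e s - A s t) \<le> norm (e u - e s - A s u) + norm (e t - e u - A u t) +
        norm ((G u t (\<theta> s) - G u t (\<eta> s)) - (G u t (\<theta> u) - G u t (\<eta> u)))"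
      by (simp only:) (rule order_trans[OF norm_triangle_ineq4 add_right_mono[OF norm_triangle_ineq]])
    moreover have "norm ((G u t (\<theta> s) - G u t (\<eta> s)) - (G u t (\<theta> u) - G u t (\<eta> u)))
      \<le> N * (t - s) powr (\<gamma> + 1/2)"
    proof -
      \<comment> \<open>Both curves move by at most \<open>M * h\<close>, which is the
        \<open>m\<close> of the four-point estimate; its square root supplies the missing half power
        of \<open>h\<close>.\<close>
      have "norm ((G u t (\<theta> s) - G u t (\<eta> s)) - (G u t (\<theta> u) - G u t (\<eta> u))) \<le>
        (L * (t - u) powr \<gamma>) * (norm ((\<theta> s - \<eta> s) - (\<theta> u - \<eta> u)) + sqrt (M * h) * norm (\<theta> u - \<eta> u))"
        unfolding G_def using u st ac lip
        by (intro holder_deriv_bound_four_points[OF hold] R) auto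
      also have "\<dots> = (L * (t - u) powr \<gamma>) * (norm (e u - e s) + sqrt (M * h) * norm (e u))"
        by (simp add: e_def norm_minus_commute)
      also have "\<dots> \<le> (L * h powr \<gamma>) * (S * sqrt h + sqrt (M * h) * S)"
      proof (intro mult_mono add_mono)
        show "(t - u) powr \<gamma> \<le> h powr \<gamma>" using u h \<gamma> by (intro powr_mono2) auto
        have "norm (e u - e s) \<le> Q * sqrt (u - s)" using st u by (intro eQ) auto
        also have "\<dots> \<le> S * sqrt h" using Q u h by (intro mult_mono) (auto simp: S_def)
        finally show "norm (e u - e s) \<le> S * sqrt h" .
        show "norm (e u) \<le> S" using eS u st by auto
      qed (use L M h S0 in auto)
      also have "\<dots> = N * (h powr \<gamma> * h powr (1/2))"
        using h by (simp add: N_def real_sqrt_mult powr_half_sqrt algebra_simps)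
      also have "\<dots> = N * (t - s) powr (\<gamma> + 1/2)" by (simp add: h_def powr_add)
      finally show ?thesis .
    qed
    ultimately show "norm (e t - e s - A s t) \<le> norm (e ((s + t) / 2) - e s - A s ((s + t) / 2)) +
        norm (e t - e ((s + t) / 2) - A ((s + t) / 2) t) + N * (t - s) powr (\<gamma> + 1/2)"
      unfolding u_def by linarith
  next
    fix \<epsilon> :: real assume \<epsilon>: "\<epsilon> > 0"
    obtain \<delta>1 where 1: "\<delta>1 > 0" "\<And>s t. 0 \<le> s \<Longrightarrow> s < t \<Longrightarrow> t \<le> 1 \<Longrightarrow> t - s \<le> \<delta>1 \<Longrightarrow>
        norm (\<theta> t - \<theta> s - G s t (\<theta> s)) \<le> \<epsilon> / 2 * (t - s)"
      unfolding G_def using integral_curve_remainder[OF cont curves(1), of "\<epsilon> / 2"] \<epsilon> by auto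
    obtain \<delta>2 where 2: "\<delta>2 > 0" "\<And>s t. 0 \<le> s \<Longrightarrow> s < t \<Longrightarrow> t \<le> 1 \<Longrightarrow> t - s \<le> \<delta>2 \<Longrightarrow>
        norm (\<eta> t - \<eta> s - G s t (\<eta> s)) \<le> \<epsilon> / 2 * (t - s)"
      unfolding G_def using integral_curve_remainder[OF cont curves(2), of "\<epsilon> / 2"] \<epsilon> by auto
    have "norm (e t - e s - A s t) \<le> \<epsilon> * (t - s)"
      if st: "a \<le> s" "s < t" "t \<le> c" "t - s \<le> min \<delta>1 \<delta>2" for s t
    proof -
      have "e t - e s - A s t = (\<theta> t - \<theta> s - G s t (\<theta> s)) - (\<eta> t - \<eta> s - G s t (\<eta> s))"
        by (simp add: e_def A_def)
      also have "norm \<dots> \<le> norm (\<theta> t - \<theta> s - G s t (\<theta> s)) + norm (\<eta> t - \<eta> s - G s t (\<eta> s))"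
        by (rule norm_triangle_ineq4)
      also have "\<dots> \<le> \<epsilon> / 2 * (t - s) + \<epsilon> / 2 * (t - s)"
        using st ac by (intro add_mono 1 2) auto
      finally show ?thesis by simp
    qed
    then show "\<exists>\<delta>>0. \<forall>s t. a \<le> s \<longrightarrow> s < t \<longrightarrow> t \<le> c \<longrightarrow> t - s \<le> \<delta> \<longrightarrow>
        norm (e t - e s - A s t) \<le> \<epsilon> * (t - s)"
      using 1(1) 2(1) by (intro exI[of _ "min \<delta>1 \<delta>2"]) auto
  qed (use \<gamma> N0 st in auto)
  define h where "h = t - s"
  define C where "C = 1 / (1 - 2 powr (1/2 - \<gamma>))"
  have h: "0 < h" "h \<le> 1" "h \<le> c - a" using st ac by (auto simp: h_def)
  have "2 powr (1/2 - \<gamma>) < 1" using \<gamma> by (simp add: powr_less_one)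
  then have C: "C \<ge> 0" by (simp add: C_def)
  have rem': "norm (e t - e s - A s t) \<le> C * N * h powr \<gamma>"
  proof -
    have "norm (e t - e s - A s t) \<le> C * N * h powr (\<gamma> + 1/2)"
      using remain by (simp add: C_def h_def)
    \<comment> \<open>As \<open>h \<le> 1\<close>, the extra half power can be given up.\<close>
    also have "\<dots> \<le> C * N * h powr \<gamma>"
      using C N0 h by (intro mult_left_mono powr_mono') auto
    finally show ?thesis .
  qed
  have "norm (A s t) \<le> (L * h powr \<gamma>) * norm (e s)"
    unfolding A_def G_def e_def h_def using st ac
    by (intro holder_deriv_bound_lipschitz[OF hold] R) auto
  also have "\<dots> \<le> (L * h powr \<gamma>) * S"
    using L st by (intro mult_left_mono eS) auto
  finally have "norm (e t - e s) \<le> (L * h powr \<gamma>) * S + C * N * h powr \<gamma>"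
    using rem' norm_triangle_ineq[of "e t - e s - A s t" "A s t"] by simp
  also have "\<dots> = L * (1 + (1 + sqrt M) * C) * S * h powr \<gamma>"
    by (simp add: N_def algebra_simps)
  also have "h powr \<gamma> = h powr (\<gamma> - 1/2) * sqrt h"
    using h by (simp add: powr_half_sqrt[symmetric] flip: powr_add)
  also have "L * (1 + (1 + sqrt M) * C) * S * (h powr (\<gamma> - 1/2) * sqrt h) \<le>
      L * (1 + (1 + sqrt M) * C) * S * ((c - a) powr (\<gamma> - 1/2) * sqrt h)"
    using L C M S0 h \<gamma> by (intro mult_left_mono mult_right_mono powr_mono2) auto
  finally show ?thesis by (simp add: C_def S_def h_def mult_ac)
qed

text \<open>A curve starting in the ball of radius \<open>\<rho>\<close> has speed at most
  \<open>M\<close> and stays within \<open>\<rho> + M\<close>, so one \<open>L\<close> serves all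
  curves. The distance at most doubles over a length \<open>\<tau>\<close> that does not depend on
  the curves, whence \<open>K = 2 ^ m\<close> for \<open>m\<close> such steps.\<close>

lemma integral_curve_stability:
  fixes f :: "real \<Rightarrow> 'a::euclidean_space \<Rightarrow> 'a"
  assumes cont: "continuous_on ({0..1} \<times> UNIV) (\<lambda>(r, x). f r x)"
    and bnd: "\<And>r x. r \<in> {0..1} \<Longrightarrow> norm (f r x) \<le> M"
    and hold: "\<And>s t. 0 \<le> s \<Longrightarrow> s < t \<Longrightarrow> t \<le> 1 \<Longrightarrow>
      holder_deriv_bound (L * (t - s) powr \<gamma>) (\<rho> + M) (\<lambda>x. integral {s..t} (\<lambda>r. f r x))"
    and L: "L \<ge> 0" and \<gamma>: "\<gamma> > 1/2"
  shows "\<exists>K\<ge>0. \<forall>x\<in>cball 0 \<rho>. \<forall>y\<in>cball 0 \<rho>. \<forall>\<theta> \<eta>. \<forall>t\<in>{0..1}.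
    integral_curve f x \<theta> \<longrightarrow> integral_curve f y \<eta> \<longrightarrow> norm (\<theta> t - \<eta> t) \<le> K * norm (x - y)"
proof -
  define B where "B = L * (1 + (1 + sqrt M) / (1 - 2 powr (1/2 - \<gamma>)))"
  have M: "M \<ge> 0" using bnd[of 0 0] norm_ge_zero[of "f 0 0"] by (smt (verit) atLeastAtMost_iff)
  have "2 powr (1/2 - \<gamma>) < 1" using \<gamma> by (simp add: powr_less_one)
  then have B: "B \<ge> 0" using L M by (simp add: B_def)
  \<comment> \<open>Chosen so that \<open>B * \<tau> powr (\<gamma> - 1/2)\<close> equals
    \<open>B / (4 * (B + 1))\<close>, which is at most \<open>1/4\<close>; the summand
    \<open>1\<close> covers \<open>B = 0\<close>.\<close>
  define \<tau> where "\<tau> = (1 / (4 * (B + 1))) powr (1 / (\<gamma> - 1/2))"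
  have \<tau>: "\<tau> > 0" using B by (simp add: \<tau>_def)
  have B\<tau>: "B * d powr (\<gamma> - 1/2) \<le> 1/4" if "0 \<le> d" "d \<le> \<tau>" for d
  proof -
    have "d powr (\<gamma> - 1/2) \<le> \<tau> powr (\<gamma> - 1/2)" using that \<gamma> by (intro powr_mono2) auto
    also have "\<dots> = 1 / (4 * (B + 1))" using B \<gamma> by (simp add: \<tau>_def powr_powr)
    finally have "B * d powr (\<gamma> - 1/2) \<le> B * (1 / (4 * (B + 1)))" using B by (intro mult_left_mono) auto
    also have "\<dots> \<le> 1/4" using B by (simp add: field_simps)
    finally show ?thesis .
  qed
  obtain m where m: "1 < real m * \<tau>" using reals_Archimedean3[OF \<tau>] by blast
  have "norm (\<theta> t - \<eta> t) \<le> 2 ^ m * norm (x - y)"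
    if xy: "x \<in> cball 0 \<rho>" "y \<in> cball 0 \<rho>" and curves: "integral_curve f x \<theta>" "integral_curve f y \<eta>"
      and t: "t \<in> {0..1}" for x y \<theta> \<eta> t
  proof -
    define e where "e = (\<lambda>t. \<theta> t - \<eta> t)"
    have init: "\<theta> 0 = x" "\<eta> 0 = y" using curves by (auto simp: integral_curve_def)
    have R: "\<theta> t \<in> cball 0 (\<rho> + M)" "\<eta> t \<in> cball 0 (\<rho> + M)" if t: "t \<in> {0..1}" for t
    proof -
      have "M * t \<le> M" using t M by (simp add: mult_left_le)
      then show "\<theta> t \<in> cball 0 (\<rho> + M)" "\<eta> t \<in> cball 0 (\<rho> + M)"
        using integral_curve_lipschitz[OF cont bnd curves(1), of 0 t]
          integral_curve_lipschitz[OF cont bnd curves(2), of 0 t] t xy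
          norm_triangle_ineq[of "\<theta> t - x" x] norm_triangle_ineq[of "\<eta> t - y" y]
        by (auto simp: init)
    qed
    have doubling: "norm (e t) \<le> 2 * norm (e a)" if at: "0 \<le> a" "a < t" "t \<le> 1" "t - a \<le> \<tau>" for a t
    proof -
      define q where "q = norm (e a) / 2"
      \<comment> \<open>Iterating the improvement of the constant avoids taking the optimal one, a supremum.\<close>
      have iter: "norm (e v - e u) \<le> (q + 2 * M / 2 ^ n) * sqrt (v - u)"
        if "a \<le> u" "u < v" "v \<le> t" for n u v
        using that
      proof (induction n arbitrary: u v)
        case 0
        have "e v - e u = (\<theta> v - \<theta> u) - (\<eta> v - \<eta> u)" by (simp add: e_def)
        also have "norm \<dots> \<le> norm (\<theta> v - \<theta> u) + norm (\<eta> v - \<eta> u)" by (rule norm_triangle_ineq4)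
        also have "\<dots> \<le> M * (v - u) + M * (v - u)"
          using 0 at integral_curve_lipschitz[OF cont bnd curves(1), of u v]
            integral_curve_lipschitz[OF cont bnd curves(2), of u v] by (intro add_mono) auto
        \<comment> \<open>The Lipschitz bound gives the first Hoelder constant \<open>2 * M\<close>,
          because \<open>v - u \<le> 1\<close>.\<close>
        also have "\<dots> = 2 * M * (sqrt (v - u) * sqrt (v - u))" using 0 by simp
        also have "\<dots> \<le> 2 * M * (1 * sqrt (v - u))"
          using 0 at M by (intro mult_left_mono mult_right_mono) auto
        also have "\<dots> \<le> (q + 2 * M / 2 ^ 0) * sqrt (v - u)"
          using 0 by (simp add: q_def algebra_simps)
        finally show ?case .
      next
        case (Suc n)
        define Q where "Q = q + 2 * M / 2 ^ n"
        have Q: "Q \<ge> 0" using M by (simp add: Q_def q_def)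
        have "norm (e v - e u) \<le> B * (t - a) powr (\<gamma> - 1/2) * (norm (e a) + Q) * sqrt (v - u)"
          unfolding B_def
          by (rule holder_constant_improvement[OF cont bnd hold L \<gamma> curves R _ _ Q e_def])
            (use Suc at in \<open>auto simp: Q_def\<close>)
        also have "\<dots> \<le> 1/4 * (norm (e a) + Q) * sqrt (v - u)"
          using at Q Suc.prems by (intro mult_right_mono B\<tau>) auto
        also have "\<dots> \<le> (q + 2 * M / 2 ^ Suc n) * sqrt (v - u)"
        proof (intro mult_right_mono)
          \<comment> \<open>The improved constant is \<open>3/4 * q + \<kappa> / 2\<close>, while
            \<open>q + \<kappa>\<close> is allowed: the excess over \<open>q\<close> halves at each
            round.\<close>
          define \<kappa> where "\<kappa> = M / 2 ^ n"
          have "\<kappa> \<ge> 0" "q \<ge> 0" using M by (auto simp: q_def \<kappa>_def)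
          moreover have "norm (e a) = 2 * q" "Q = q + 2 * \<kappa>" "2 * M / 2 ^ Suc n = \<kappa>"
            by (simp_all add: q_def Q_def \<kappa>_def)
          ultimately show "1/4 * (norm (e a) + Q) \<le> q + 2 * M / 2 ^ Suc n" by simp
        qed (use Suc.prems in auto)
        finally show ?case .
      qed
      have "(\<lambda>n. (q + 2 * M * (1/2) ^ n) * sqrt (t - a)) \<longlonglongrightarrow> (q + 2 * M * 0) * sqrt (t - a)"
        by (intro tendsto_intros LIMSEQ_power_zero) auto
      then have "norm (e t - e a) \<le> (q + 2 * M * 0) * sqrt (t - a)"
        by (rule LIMSEQ_le_const) (use iter[of a t] at in \<open>auto simp: power_divide\<close>)
      also have "\<dots> \<le> q * 1" using at by (simp add: q_def mult_left_le)
      finally have "norm (e t - e a) \<le> norm (e a)" unfolding q_def using norm_ge_zero[of "e a"] by linarith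
      then show ?thesis using norm_triangle_ineq[of "e t - e a" "e a"] by simp
    qed
    have "norm (e t) \<le> 2 ^ k * norm (e 0)" if "0 \<le> t" "t \<le> 1" "t \<le> real k * \<tau>" for k t
      using that
    proof (induction k arbitrary: t)
      case (Suc k)
      show ?case
      proof (cases "t \<le> real k * \<tau>")
        case True
        have "norm (e t) \<le> 2 ^ k * norm (e 0)" using True Suc by auto
        also have "\<dots> \<le> 2 ^ Suc k * norm (e 0)" by (intro mult_right_mono) auto
        finally show ?thesis .
      next
        case False
        have "norm (e t) \<le> 2 * norm (e (real k * \<tau>))"
          \<comment> \<open>The grid point \<open>real k * \<tau>\<close> lies before
            \<open>t\<close> at distance at most \<open>\<tau>\<close>.\<close>
          using False Suc.prems \<tau> by (intro doubling) (auto simp: algebra_simps)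
        also have "norm (e (real k * \<tau>)) \<le> 2 ^ k * norm (e 0)"
          using False Suc.prems \<tau> by (intro Suc.IH) auto
        finally show ?thesis by simp
      qed
    qed simp
    from this[of t m] show ?thesis using t m by (auto simp: e_def init)
  qed
  then show ?thesis by (intro exI[of _ "2 ^ m"]) auto
qed

section \<open>Existence by Euler approximation and compactness\<close>

text \<open>On each mesh interval the field is integrated along the value of the curve at the left
  endpoint. The defect grows at rate at most \<open>\<epsilon>\<close>, so the bound
  \<open>\<epsilon> * t\<close> passes from one mesh point to the next.\<close>

lemma euler_approximation:
  fixes f :: "real \<Rightarrow> 'a::euclidean_space \<Rightarrow> 'a"
  assumes cont: "continuous_on ({0..1} \<times> UNIV) (\<lambda>(r, x). f r x)"
    and bnd: "\<And>r x. r \<in> {0..1} \<Longrightarrow> norm (f r x) \<le> M"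
    and \<epsilon>: "\<epsilon> > 0"
  shows "\<exists>\<theta>. \<theta> 0 = x0 \<and> M-lipschitz_on {0..1} \<theta> \<and>
    (\<forall>t\<in>{0..1}. norm (\<theta> t - x0 - integral {0..t} (\<lambda>r. f r (\<theta> r))) \<le> \<epsilon> * t)"
proof -
  have M: "M \<ge> 0" using bnd[of 0 0] norm_ge_zero[of "f 0 0"] by (smt (verit) atLeastAtMost_iff)
  \<comment> \<open>Speed at most \<open>M\<close> keeps the approximation in
    \<open>cball x0 M\<close> up to time \<open>1\<close>, so uniform continuity on a compact set
    suffices.\<close>
  define K where "K = ({0..1} :: real set) \<times> cball x0 M"
  have "uniformly_continuous_on K (\<lambda>(r, x). f r x)"
    unfolding K_def
    by (intro compact_uniformly_continuous compact_Times continuous_on_subset[OF cont]) auto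
  then obtain d where d: "d > 0" and D: "\<And>p q. p \<in> K \<Longrightarrow> q \<in> K \<Longrightarrow>
      dist q p < d \<Longrightarrow> dist ((\<lambda>(r, x). f r x) q) ((\<lambda>(r, x). f r x) p) < \<epsilon>"
    using \<epsilon> unfolding uniformly_continuous_on_def by metis
  \<comment> \<open>With mesh \<open>1 / n\<close> the curve moves by less than \<open>d\<close>
    within one mesh interval.\<close>
  obtain n where n: "n > 0" "M / real n < d"
  proof -
    obtain n where "M / d < real n" using reals_Archimedean2 by blast
    then have "M / real (Suc n) < d" using d M by (simp add: field_simps)
    then show thesis using that[of "Suc n"] by auto
  qed
  define P where "P = (\<lambda>c \<theta>. \<theta> 0 = x0 \<and> M-lipschitz_on {0..c} \<theta> \<and>
    (\<forall>t\<in>{0..c}. norm (\<theta> t - x0 - integral {0..t} (\<lambda>r. f r (\<theta> r))) \<le> \<epsilon> * t))"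
  have "\<exists>\<theta>. P (real k / real n) \<theta>" if "k \<le> n" for k
    using that
  proof (induction k)
    case 0
    show ?case by (rule exI[of _ "\<lambda>_. x0"]) (auto simp: P_def lipschitz_on_def M)
  next
    case (Suc k)
    define a where "a = real k / real n"
    define c where "c = real (Suc k) / real n"
    have ac: "0 \<le> a" "a < c" "c \<le> 1" "c - a = 1 / real n"
      using Suc.prems n(1) by (auto simp: a_def c_def field_simps)
    obtain \<theta> where \<theta>: "\<theta> 0 = x0" "M-lipschitz_on {0..a} \<theta>"
      "\<And>t. t \<in> {0..a} \<Longrightarrow> norm (\<theta> t - x0 - integral {0..t} (\<lambda>r. f r (\<theta> r))) \<le> \<epsilon> * t"
      using Suc by (auto simp: P_def a_def)
    define \<zeta> where "\<zeta> = (\<lambda>t. \<theta> a + integral {a..t} (\<lambda>r. f r (\<theta> a)))"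
    define \<theta>' where "\<theta>' = (\<lambda>t. if t \<le> a then \<theta> t else \<zeta> t)"
    have fa: "continuous_on {s..t} (\<lambda>r. f r (\<theta> a))" if "a \<le> s" "t \<le> c" for s t
      using that ac by (intro continuous_on_along_curve[OF cont]) auto
    have "M-lipschitz_on {a..c} \<zeta>"
    proof (rule lipschitz_on_leI)
      fix s t assume st: "s \<in> {a..c}" "t \<in> {a..c}" "s \<le> t"
      have "integral {a..s} (\<lambda>r. f r (\<theta> a)) + integral {s..t} (\<lambda>r. f r (\<theta> a)) = integral {a..t} (\<lambda>r. f r (\<theta> a))"
        using st fa by (intro Henstock_Kurzweil_Integration.integral_combine integrable_continuous_interval) auto
      then have "\<zeta> t - \<zeta> s = integral {s..t} (\<lambda>r. f r (\<theta> a))" by (simp add: \<zeta>_def algebra_simps)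
      also have "norm \<dots> \<le> M * (t - s)"
        using st ac fa bnd by (intro integral_bound) auto
      finally show "dist (\<zeta> s) (\<zeta> t) \<le> M * dist s t"
        using st by (simp add: dist_norm norm_minus_commute)
    qed (rule M)
    then have lip: "M-lipschitz_on {0..c} \<theta>'"
      unfolding \<theta>'_def by (intro lipschitz_on_concat \<theta>) (auto simp: \<zeta>_def)
    have init: "\<theta>' 0 = x0" using ac \<theta> by (simp add: \<theta>'_def)
    have cont': "continuous_on {s..t} (\<lambda>r. f r (\<theta>' r))" if "0 \<le> s" "t \<le> c" for s t
      using that ac
      by (intro continuous_on_along_curve[OF cont] continuous_on_subset[OF lipschitz_on_continuous_on[OF lip]]) auto
    have K: "(r, \<theta>' s) \<in> K" if "r \<in> {0..c}" "s \<in> {0..c}" for r s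
    proof -
      have "dist (\<theta>' 0) (\<theta>' s) \<le> M * dist 0 s" using that ac by (intro lipschitz_onD[OF lip]) auto
      also have "\<dots> \<le> M * 1" using that ac M by (intro mult_left_mono) auto
      finally show ?thesis using that ac by (auto simp: K_def init)
    qed
    have "norm (\<theta>' t - x0 - integral {0..t} (\<lambda>r. f r (\<theta>' r))) \<le> \<epsilon> * t" if t: "t \<in> {0..c}" for t
    proof (cases "t \<le> a")
      case True
      then have "integral {0..t} (\<lambda>r. f r (\<theta>' r)) = integral {0..t} (\<lambda>r. f r (\<theta> r))"
        by (intro integral_cong) (auto simp: \<theta>'_def)
      then show ?thesis using True t \<theta>(3)[of t] by (simp add: \<theta>'_def)
    next
      case False
      have \<theta>'t: "\<theta>' t = \<zeta> t" using False by (simp add: \<theta>'_def)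
      have eq: "integral {0..a} (\<lambda>r. f r (\<theta>' r)) = integral {0..a} (\<lambda>r. f r (\<theta> r))"
        by (intro integral_cong) (auto simp: \<theta>'_def)
      have "integral {0..a} (\<lambda>r. f r (\<theta>' r)) + integral {a..t} (\<lambda>r. f r (\<theta>' r)) = integral {0..t} (\<lambda>r. f r (\<theta>' r))"
        using t False ac cont'
        by (intro Henstock_Kurzweil_Integration.integral_combine integrable_continuous_interval) auto
      moreover have "integral {a..t} (\<lambda>r. f r (\<theta> a) - f r (\<theta>' r)) =
          integral {a..t} (\<lambda>r. f r (\<theta> a)) - integral {a..t} (\<lambda>r. f r (\<theta>' r))"
        using t False ac cont' fa
        by (intro Henstock_Kurzweil_Integration.integral_diff integrable_continuous_interval) auto
      ultimately have "integral {0..t} (\<lambda>r. f r (\<theta>' r)) = integral {0..a} (\<lambda>r. f r (\<theta> r)) +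
          integral {a..t} (\<lambda>r. f r (\<theta> a)) - integral {a..t} (\<lambda>r. f r (\<theta> a) - f r (\<theta>' r))"
        unfolding eq[symmetric] by simp
      \<comment> \<open>The defect at \<open>t\<close> is the defect at \<open>a\<close> plus the
        error of freezing the curve over \<open>[a, t]\<close>.\<close>
      then have split: "\<theta>' t - x0 - integral {0..t} (\<lambda>r. f r (\<theta>' r)) =
          (\<theta> a - x0 - integral {0..a} (\<lambda>r. f r (\<theta> r))) + integral {a..t} (\<lambda>r. f r (\<theta> a) - f r (\<theta>' r))"
        unfolding \<theta>'t \<zeta>_def by simp
      have "norm (integral {a..t} (\<lambda>r. f r (\<theta> a) - f r (\<theta>' r))) \<le> \<epsilon> * (t - a)"
      proof (rule integral_bound)
        fix r assume r: "r \<in> {a..t}"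
        have "dist (\<theta>' a) (\<theta>' r) \<le> M * dist a r" using r t ac by (intro lipschitz_onD[OF lip]) auto
        also have "\<dots> \<le> M * (c - a)" using r t M by (intro mult_left_mono) (auto simp: dist_real_def)
        also have "\<dots> < d" using n by (simp add: ac)
        finally have "dist (r, \<theta>' a) (r, \<theta>' r) < d" by (simp add: dist_prod_def)
        then have "dist (f r (\<theta>' a)) (f r (\<theta>' r)) < \<epsilon>"
          using D[of "(r, \<theta>' r)" "(r, \<theta>' a)"] K r t ac by auto
        then show "norm (f r (\<theta> a) - f r (\<theta>' r)) \<le> \<epsilon>"
          by (simp add: \<theta>'_def dist_norm)
      qed (use t False ac cont' fa in \<open>auto intro!: continuous_intros\<close>)
      then show ?thesis
        unfolding split using \<theta>(3)[of a] ac
        by (intro norm_triangle_le) (auto simp: algebra_simps)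
    qed
    then show ?case using init lip by (auto simp: P_def c_def intro!: exI[of _ \<theta>'])
  qed
  from this[of n] show ?thesis using n by (simp add: P_def)
qed

text \<open>The approximations share the initial value and the Lipschitz constant, so Arzela-Ascoli
  yields a uniformly convergent subsequence. Dominated convergence passes to the limit in the
  integral, and the defects tend to zero.\<close>

theorem peano_existence:
  fixes f :: "real \<Rightarrow> 'a::euclidean_space \<Rightarrow> 'a"
  assumes cont: "continuous_on ({0..1} \<times> UNIV) (\<lambda>(r, x). f r x)"
    and bnd: "\<And>r x. r \<in> {0..1} \<Longrightarrow> norm (f r x) \<le> M"
  shows "\<exists>\<theta>. integral_curve f x0 \<theta>"
proof -
  have M: "M \<ge> 0" using bnd[of 0 0] norm_ge_zero[of "f 0 0"] by (smt (verit) atLeastAtMost_iff)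
  have "\<forall>n. \<exists>\<theta>. \<theta> 0 = x0 \<and> M-lipschitz_on {0..1} \<theta> \<and>
    (\<forall>t\<in>{0..1}. norm (\<theta> t - x0 - integral {0..t} (\<lambda>r. f r (\<theta> r))) \<le> inverse (real (Suc n)) * t)"
    by (intro allI euler_approximation[OF cont bnd]) auto
  then obtain \<Theta> where \<Theta>: "\<And>n. \<Theta> n 0 = x0" "\<And>n. M-lipschitz_on {0..1} (\<Theta> n)"
    "\<And>n t. t \<in> {0..1} \<Longrightarrow>
      norm (\<Theta> n t - x0 - integral {0..t} (\<lambda>r. f r (\<Theta> n r))) \<le> inverse (real (Suc n)) * t"
    by metis
  have lip: "norm (\<Theta> n s - \<Theta> n t) \<le> M * \<bar>s - t\<bar>" if "s \<in> {0..1}" "t \<in> {0..1}" for n s t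
    using lipschitz_onD[OF \<Theta>(2) that] by (simp add: dist_norm)
  obtain \<theta> k where lim: "continuous_on {0..1} \<theta>" "strict_mono (k :: nat \<Rightarrow> nat)"
    "\<And>e. 0 < e \<Longrightarrow> \<exists>N. \<forall>n x. n \<ge> N \<and> x \<in> {0..1} \<longrightarrow> norm (\<Theta> (k n) x - \<theta> x) < e"
  proof (rule Arzela_Ascoli[of "{0..1::real}" \<Theta> "norm x0 + M"])
    fix n t assume t: "t \<in> {0..1::real}"
    have "norm (\<Theta> n t - \<Theta> n 0) \<le> M * \<bar>t - 0\<bar>" using t by (intro lip) auto
    also have "\<dots> \<le> M * 1" using t M by (intro mult_left_mono) auto
    finally show "norm (\<Theta> n t) \<le> norm x0 + M"
      using norm_triangle_ineq[of "\<Theta> n t - x0" x0] by (simp add: \<Theta>)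
  next
    fix s e :: real assume s: "s \<in> {0..1}" and e: "0 < e"
    \<comment> \<open>The denominator \<open>M + 1\<close> allows for \<open>M = 0\<close>.\<close>
    have "norm (\<Theta> n s - \<Theta> n t) < e" if "t \<in> {0..1}" "norm (s - t) < e / (M + 1)" for n t
    proof -
      have "norm (\<Theta> n s - \<Theta> n t) \<le> M * \<bar>s - t\<bar>" using s that by (intro lip)
      also have "\<dots> \<le> (M + 1) * \<bar>s - t\<bar>" by (intro mult_right_mono) auto
      also have "\<dots> < e" using that M by (simp add: field_simps)
      finally show ?thesis .
    qed
    then show "\<exists>d. 0 < d \<and> (\<forall>n y. y \<in> {0..1} \<and> norm (s - y) < d \<longrightarrow> norm (\<Theta> n s - \<Theta> n y) < e)"
      using e M by (intro exI[of _ "e / (M + 1)"]) auto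
  qed auto
  have ptw: "(\<lambda>n. \<Theta> (k n) t) \<longlonglongrightarrow> \<theta> t" if "t \<in> {0..1}" for t
    unfolding LIMSEQ_def dist_norm using lim(3) that by metis
  have "\<theta> t = x0 + integral {0..t} (\<lambda>r. f r (\<theta> r))" if t: "t \<in> {0..1}" for t
  proof -
    have fc: "((\<lambda>n. f r (\<Theta> (k n) r)) \<longlonglongrightarrow> f r (\<theta> r))" if r: "r \<in> {0..t}" for r
    proof -
      have "continuous_on UNIV (f r)"
        using continuous_on_compose2[OF cont, of UNIV "\<lambda>x. (r, x)"] r t
        by (force intro!: continuous_on_Pair)
      then have "isCont (f r) (\<theta> r)" by (simp add: continuous_on_eq_continuous_at)
      then show ?thesis using ptw[of r] r t by (intro isCont_tendsto_compose[of _ "f r"]) auto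
    qed
    have "(\<lambda>n. integral {0..t} (\<lambda>r. f r (\<Theta> (k n) r))) \<longlonglongrightarrow> integral {0..t} (\<lambda>r. f r (\<theta> r))"
    proof (rule dominated_convergence(2)[where h = "\<lambda>_. M"])
      show "(\<lambda>r. f r (\<Theta> (k n) r)) integrable_on {0..t}" for n
        using t by (intro integrable_continuous_interval continuous_on_along_curve[OF cont]
            continuous_on_subset[OF lipschitz_on_continuous_on[OF \<Theta>(2)]]) auto
    qed (use bnd t fc in auto)
    then have "(\<lambda>n. \<Theta> (k n) t - x0 - integral {0..t} (\<lambda>r. f r (\<Theta> (k n) r))) \<longlonglongrightarrow>
        \<theta> t - x0 - integral {0..t} (\<lambda>r. f r (\<theta> r))"
      using ptw[OF t] by (intro tendsto_intros)
    moreover have "(\<lambda>n. \<Theta> (k n) t - x0 - integral {0..t} (\<lambda>r. f r (\<Theta> (k n) r))) \<longlonglongrightarrow> 0"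
    proof (rule Lim_null_comparison)
      show "\<forall>\<^sub>F n in sequentially. norm (\<Theta> (k n) t - x0 - integral {0..t} (\<lambda>r. f r (\<Theta> (k n) r))) \<le>
          inverse (real (Suc (k n))) * t"
        using \<Theta>(3)[OF t] by (intro always_eventually) auto
      have "(\<lambda>n. inverse (real (Suc (k n)))) \<longlonglongrightarrow> 0"
        using LIMSEQ_subseq_LIMSEQ[OF LIMSEQ_inverse_real_of_nat lim(2)] by (simp add: o_def)
      then show "(\<lambda>n. inverse (real (Suc (k n))) * t) \<longlonglongrightarrow> 0"
        by (rule tendsto_mult_left_zero)
    qed
    ultimately have "\<theta> t - x0 - integral {0..t} (\<lambda>r. f r (\<theta> r)) = 0" by (rule LIMSEQ_unique)
    then show ?thesis by (simp add: algebra_simps)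
  qed
  then show ?thesis using lim(1) by (auto simp: integral_curve_def)
qed

section \<open>Return to the perturbed equation\<close>

lemma solves_iff_integral_curve:
  fixes w :: "real \<Rightarrow> real ^ 'n"
  assumes "continuous_on {0..1} w"
  shows "solves w b x0 x \<longleftrightarrow> integral_curve (\<lambda>r z. b (z + w r)) x0 (\<lambda>t. x t - w t)"
proof -
  have "continuous_on {0..1} (\<lambda>t. x t - w t) \<Longrightarrow> continuous_on {0..1} (\<lambda>t. (x t - w t) + w t)"
    by (intro continuous_on_add assms)
  then have "continuous_on {0..1} x" if "continuous_on {0..1} (\<lambda>t. x t - w t)" using that by simp
  then show ?thesis
    using assms by (auto simp: solves_def integral_curve_def algebra_simps intro!: continuous_intros)
qed

theorem theorem1p8:
  fixes w :: "real \<Rightarrow> real ^ 'n"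
    and b :: "real ^ 'n \<Rightarrow> real ^ 'n"
    and \<gamma> :: real
    and \<psi> :: "real \<Rightarrow> real"
  assumes "continuous_on {0..1} w" and "w 0 = 0"
    and "bounded (range b)" and "continuous_on UNIV b"
    and "\<gamma> > 1/2"
    and "weight \<psi>"
    and "time_Holder_C32_norm \<gamma> \<psi> (averaging w b) < \<infinity>"
  shows "(\<forall>x0. \<exists>x. solves w b x0 x \<and> (\<forall>y. solves w b x0 y \<longrightarrow> (\<forall>t\<in>{0..1}. y t = x t))) \<and>
         (\<forall>\<Phi>. (\<forall>x0. solves w b x0 (\<Phi> x0)) \<longrightarrow>
           (\<forall>z. \<exists>u>0. \<exists>L. \<forall>t\<in>{0..1}. L-lipschitz_on (cball z u) (\<lambda>x0. \<Phi> x0 t)))"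
proof -
  define f where "f = (\<lambda>r z. b (z + w r))"
  obtain M where M: "M > 0" "\<And>z. norm (b z) \<le> M"
    using assms(3) by (auto simp: bounded_pos)
  have bnd: "\<And>r x. r \<in> {0..1::real} \<Longrightarrow> norm (f r x) \<le> M" using M by (simp add: f_def)
  have cont: "continuous_on ({0..1} \<times> UNIV) (\<lambda>(r, x). f r x)"
  proof -
    have "continuous_on ({0..1} \<times> UNIV) (\<lambda>p. b (snd p + w (fst p)))"
      by (intro continuous_on_compose2[OF assms(4)] continuous_intros
          continuous_on_compose2[OF assms(1)]) auto
    then show ?thesis by (simp add: f_def case_prod_beta)
  qed
  have sol: "solves w b x0 x \<longleftrightarrow> integral_curve f x0 (\<lambda>t. x t - w t)" for x0 x
    unfolding f_def by (rule solves_iff_integral_curve[OF assms(1)])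
  \<comment> \<open>Identifies the increments of the averaging operator with the integrals of the
    shifted field, to which the stability estimate applies.\<close>
  have incr: "averaging w b t x - averaging w b s x = integral {s..t} (\<lambda>r. f r x)"
    if "0 \<le> s" "s < t" "t \<le> 1" for s t x
  proof -
    have "integral {0..s} (\<lambda>r. f r x) + integral {s..t} (\<lambda>r. f r x) = integral {0..t} (\<lambda>r. f r x)"
      using that by (intro Henstock_Kurzweil_Integration.integral_combine integrable_continuous_interval
          continuous_on_along_curve[OF cont]) auto
    then show ?thesis by (simp add: averaging_def f_def algebra_simps)
  qed
  \<comment> \<open>One estimate gives both claims: equal initial values yield uniqueness, different
    ones the Lipschitz bound. \<open>K\<close> is fixed before \<open>t\<close>, hence the
    uniformity in time.\<close>
  have stab: "\<exists>K\<ge>0. \<forall>x0\<in>cball 0 \<rho>. \<forall>y0\<in>cball 0 \<rho>. \<forall>x y. \<forall>t\<in>{0..1}.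
      solves w b x0 x \<longrightarrow> solves w b y0 y \<longrightarrow> norm (x t - y t) \<le> K * norm (x0 - y0)"
    if \<rho>: "\<rho> \<ge> 0" for \<rho>
  proof -
    obtain L where L: "L \<ge> 0" "\<And>s t. 0 \<le> s \<Longrightarrow> s < t \<Longrightarrow> t \<le> 1 \<Longrightarrow>
        holder_deriv_bound (L * (t - s) powr \<gamma>) (\<rho> + M) (\<lambda>x. averaging w b t x - averaging w b s x)"
      using time_Holder_C32_holder_deriv_bound[OF assms(7,6), of "\<rho> + M"] \<rho> M by auto
    have "holder_deriv_bound (L * (t - s) powr \<gamma>) (\<rho> + M) (\<lambda>x. integral {s..t} (\<lambda>r. f r x))"
      if "0 \<le> s" "s < t" "t \<le> 1" for s t
      using L(2)[OF that] incr[OF that] by simp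
    from integral_curve_stability[OF cont bnd this L(1) assms(5)]
    obtain K where K: "K \<ge> 0" "\<And>x y \<theta> \<eta> t. x \<in> cball 0 \<rho> \<Longrightarrow> y \<in> cball 0 \<rho> \<Longrightarrow> t \<in> {0..1} \<Longrightarrow>
        integral_curve f x \<theta> \<Longrightarrow> integral_curve f y \<eta> \<Longrightarrow> norm (\<theta> t - \<eta> t) \<le> K * norm (x - y)"
      by blast
    have "norm (x t - y t) \<le> K * norm (x0 - y0)"
      if "x0 \<in> cball 0 \<rho>" "y0 \<in> cball 0 \<rho>" "t \<in> {0..1}" "solves w b x0 x" "solves w b y0 y" for x0 y0 x y t
      using K(2)[OF that(1-3) that(4,5)[unfolded sol]] by simp
    then show ?thesis using K(1) by blast
  qed
  show ?thesis
  proof (intro conjI allI impI)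
    fix x0
    obtain \<theta> where "integral_curve f x0 \<theta>" using peano_existence[OF cont bnd] by blast
    then have "solves w b x0 (\<lambda>t. \<theta> t + w t)" by (simp add: sol)
    moreover have "y t = x t" if "solves w b x0 x" "solves w b x0 y" "t \<in> {0..1}" for x y t
    proof -
      have "x0 \<in> cball 0 (norm x0)" by simp
      then have "\<exists>K. norm (y t - x t) \<le> K * norm (x0 - x0)"
        using stab[OF norm_ge_zero, of x0] that by meson
      then show ?thesis by simp
    qed
    ultimately show "\<exists>x. solves w b x0 x \<and> (\<forall>y. solves w b x0 y \<longrightarrow> (\<forall>t\<in>{0..1}. y t = x t))"
      by blast
  next
    fix \<Phi> and z :: "real ^ 'n" assume \<Phi>: "\<forall>x0. solves w b x0 (\<Phi> x0)"
    \<comment> \<open>The ball about \<open>0\<close> of radius \<open>norm z + 1\<close> contains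
      the unit ball about \<open>z\<close>.\<close>
    obtain K where K: "K \<ge> 0" "\<And>x0 y0 t. x0 \<in> cball 0 (norm z + 1) \<Longrightarrow> y0 \<in> cball 0 (norm z + 1) \<Longrightarrow>
        t \<in> {0..1} \<Longrightarrow> norm (\<Phi> x0 t - \<Phi> y0 t) \<le> K * norm (x0 - y0)"
      using stab[of "norm z + 1"] \<Phi> by (metis add_nonneg_nonneg norm_ge_zero zero_le_one)
    have sub: "x \<in> cball 0 (norm z + 1)" if "x \<in> cball z 1" for x
      using that norm_triangle_ineq[of z "x - z"] by (simp add: dist_norm norm_minus_commute)
    have "K-lipschitz_on (cball z 1) (\<lambda>x0. \<Phi> x0 t)" if "t \<in> {0..1}" for t
      using K that sub by (intro lipschitz_onI) (auto simp only: dist_norm)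
    then show "\<exists>u>0. \<exists>L. \<forall>t\<in>{0..1}. L-lipschitz_on (cball z u) (\<lambda>x0. \<Phi> x0 t)"
      by (intro exI[of _ 1] conjI exI[of _ K]) auto
  qed
qed

end
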